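(* Suppose $F:[0,\infty)\to(0,\infty)$ is a $C^2$ function satisfying $$0<F'(x)<1,\quad F''(x)\ge0,\quad x\ge0;\qquad \int_0^\infty[1-F'(x)]\,dx=\infty,$$ and $X_0$ is a positive random variable with bounded beta function. Let $X_{n+1}=T_F(\lambda_nX_n)$, $n=0,1,2,\dots$, where the dilations $\lambda_n>0$ are chosen to satisfy $F(0)<\lambda_n\|X_n\|_\infty$, $n=0,1,2,\dots$. Then for any $\alpha$ with $0<\alpha<1$ there exists a constant $C(\alpha,X_0)>0$, depending only on $\alpha$ and $X_0$, such that $$\langle X_n^\alpha\rangle\ge C(\alpha,X_0)\,\langle X_n\rangle^\alpha,\qquad n=0,1,2,\dots$$
   Context: $\langle\cdot\rangle$ denotes expectation; random variables are positive with finite first moment. $\|X\|_\infty\in(0,\infty]$ is the essential supremum of $X$. Beta function of $X$: let $w(x)=P(X>x)$ and $h(x)=\int_x^\infty w(x')\,dx'$, $x\ge0$. Assuming $h$ is $C^2$ on $[0,\|X\|_\infty)$, the beta function is $\beta(x)=h''(x)h(x)/h'(x)^2$, $0\le x<\|X\|_\infty$. For a positive random variable $X$ with $F(0)<\|X\|_\infty$, $T_F(X)$ denotes the positive random variable with distribution $P(T_F(X)>x)=P(X>F(x))/P(X>F(0))$, $x\ge0$ (equivalently, the map $w(x)\mapsto w(F(x))$ on nonnegative decreasing integrable functions, up to normalization). *)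

theory Defs
  imports "HOL-Probability.Probability"
begin

text \<open>
  All derivatives are taken within the domain, so that they are one-sided at the left endpoint
  of \<open>[0,\<infinity>)\<close> and of \<open>[0,\<parallel>X\<parallel>\<^sub>\<infinity>)\<close>. A two-sided derivative of \<open>h'\<close> at \<open>0\<close> would be wrong: the
  tail of a positive random variable is constantly \<open>1\<close> on the negative half-line.
\<close>

definition deriv_on :: "real set \<Rightarrow> (real \<Rightarrow> real) \<Rightarrow> real \<Rightarrow> real" where
  "deriv_on S f x = vector_derivative f (at x within S)"

definition C2_on :: "real set \<Rightarrow> (real \<Rightarrow> real) \<Rightarrow> bool" where
  "C2_on S f \<longleftrightarrow> f differentiable_on S \<and> deriv_on S f differentiable_on S
     \<and> continuous_on S (deriv_on S (deriv_on S f))"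

definition positive_rv :: "'a measure \<Rightarrow> ('a \<Rightarrow> real) \<Rightarrow> bool" where
  "positive_rv M X \<longleftrightarrow> prob_space M \<and> X \<in> borel_measurable M \<and> (AE \<omega> in M. 0 < X \<omega>)"

definition ess_bound :: "'a measure \<Rightarrow> ('a \<Rightarrow> real) \<Rightarrow> ereal" where
  "ess_bound M X = esssup M (\<lambda>\<omega>. ereal (X \<omega>))"

definition tail :: "'a measure \<Rightarrow> ('a \<Rightarrow> real) \<Rightarrow> real \<Rightarrow> real" where
  "tail M X x = measure M {\<omega> \<in> space M. X \<omega> > x}"

definition tail_integral :: "'a measure \<Rightarrow> ('a \<Rightarrow> real) \<Rightarrow> real \<Rightarrow> real" where
  "tail_integral M X x = (LINT t:{x..}|lborel. tail M X t)"

definition beta_domain :: "'a measure \<Rightarrow> ('a \<Rightarrow> real) \<Rightarrow> real set" where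
  "beta_domain M X = {x. 0 \<le> x \<and> ereal x < ess_bound M X}"

definition beta_function :: "'a measure \<Rightarrow> ('a \<Rightarrow> real) \<Rightarrow> real \<Rightarrow> real" where
  "beta_function M X x =
     (let S = beta_domain M X; h = tail_integral M X
      in deriv_on S (deriv_on S h) x * h x / (deriv_on S h x)\<^sup>2)"

text \<open>The beta function is only defined when \<open>h\<close> is \<open>C\<^sup>2\<close>; having a bounded one includes this.\<close>

definition has_bounded_beta :: "'a measure \<Rightarrow> ('a \<Rightarrow> real) \<Rightarrow> bool" where
  "has_bounded_beta M X \<longleftrightarrow> C2_on (beta_domain M X) (tail_integral M X)
     \<and> (\<exists>B. \<forall>x \<in> beta_domain M X. \<bar>beta_function M X x\<bar> \<le> B)"

text \<open>
  \<open>T\<^sub>F(X)\<close> is determined only in distribution, so it is a relation: \<open>Y\<close>, living on its own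
  probability space \<open>N\<close>, is a version of \<open>T\<^sub>F(X)\<close>. It is meant for
  \<open>F 0 < \<parallel>X\<parallel>\<^sub>\<infinity>\<close>, that is, for a nonzero denominator. Finiteness of the first
  moment of \<open>Y\<close> is not required here: for the functions \<open>F\<close> below it is inherited from \<open>X\<close>, because
  \<open>F x \<ge> F 0 + F' 0 * x\<close> with \<open>F' 0 > 0\<close>. A version on the same underlying type always exists for
  these \<open>F\<close>, namely \<open>F\<^sup>-\<^sup>1 \<circ> X\<close> under \<open>M\<close> conditioned on \<open>X > F 0\<close>.
\<close>

definition is_T :: "(real \<Rightarrow> real) \<Rightarrow> 'a measure \<Rightarrow> ('a \<Rightarrow> real) \<Rightarrow> 'b measure \<Rightarrow> ('b \<Rightarrow> real) \<Rightarrow> bool"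
  where
  "is_T F M X N Y \<longleftrightarrow> positive_rv N Y \<and> (\<forall>x\<ge>0. tail N Y x = tail M X (F x) / tail M X (F 0))"

definition admissible :: "(real \<Rightarrow> real) \<Rightarrow> bool" where
  "admissible F \<longleftrightarrow>
     (\<forall>x\<ge>0. 0 < F x) \<and> C2_on {0..} F
     \<and> (\<forall>x\<ge>0. 0 < deriv_on {0..} F x \<and> deriv_on {0..} F x < 1)
     \<and> (\<forall>x\<ge>0. 0 \<le> deriv_on {0..} (deriv_on {0..} F) x)
     \<and> (\<integral>\<^sup>+x\<in>{0..}. ennreal (1 - deriv_on {0..} F x) \<partial>lborel) = \<infinity>"

text \<open>The random variables \<open>X n\<close> (on \<open>M n\<close>) satisfy \<open>X\<^sub>n\<^sub>+\<^sub>1 = T\<^sub>F(\<lambda>\<^sub>n X\<^sub>n)\<close> with \<open>l n = \<lambda>\<^sub>n\<close>.\<close>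

definition T_iteration ::
  "(real \<Rightarrow> real) \<Rightarrow> (nat \<Rightarrow> real) \<Rightarrow> (nat \<Rightarrow> 'a measure) \<Rightarrow> (nat \<Rightarrow> 'a \<Rightarrow> real) \<Rightarrow> bool" where
  "T_iteration F l M X \<longleftrightarrow>
     (\<forall>n. 0 < l n \<and> ereal (F 0) < ereal (l n) * ess_bound (M n) (X n)
        \<and> is_T F (M n) (\<lambda>\<omega>. l n * X n \<omega>) (M (Suc n)) (X (Suc n)))"

end

theory Submission
  imports Defs
begin

text \<open>
  Write \<open>w(x) = P(X\<^sub>0 > x)\<close>, \<open>h(x) = \<integral>\<^sub>x\<^sup>\<infinity> w\<close>, and let \<open>m(x) = h(x) / w(x)\<close> be the mean residual
  life \<open>E[X\<^sub>0 - x | X\<^sub>0 > x]\<close>. Unfolding the recursion, the tail of \<open>X\<^sub>n\<close> is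
  \<open>x \<mapsto> w(G(x)) / w(G(0))\<close> with \<open>G\<close> nonnegative, convex, continuous and strictly increasing on \<open>[0,\<infinity>)\<close>,
  because such functions are stable under \<open>G \<mapsto> (\<lambda>x. G(F(x) / l))\<close> (lemma \<open>T_iteration_tail\<close>).
  It therefore suffices to bound the moments of any \<open>Y\<close> with a tail of this form, by a constant that
  does not depend on \<open>G\<close> (lemma \<open>moment_inequality\<close>).

  The role of the beta function is that \<open>m' = \<beta> - 1\<close>. If \<open>\<beta> \<le> B\<close> with \<open>B \<ge> 0\<close>, then \<open>m\<close> grows at
  most linearly with slope \<open>B - 1\<close>. On the other hand \<open>h(a + b) \<ge> h(a) - b w(a)\<close>, and for
  \<open>b = m(a) / 2\<close> the two bounds give \<open>w(a + b) \<ge> w(a) / (B + 1)\<close>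
  (lemma \<open>tail_at_half_residual_life\<close>).

  Given \<open>G\<close>, put \<open>a = G(0)\<close>, \<open>b = m(a) / 2\<close>, and let \<open>c > 0\<close> solve \<open>G(c) = a + b\<close>. Then
  \<open>P(Y > c) = w(a + b) / w(a) \<ge> 1 / (B + 1)\<close>, so that \<open>E[Y\<^sup>\<alpha>] \<ge> c\<^sup>\<alpha> / (B + 1)\<close>. By convexity \<open>G\<close> lies
  above its secant through \<open>0\<close> and \<open>c\<close> to the right of \<open>c\<close>, that is,
  \<open>G(t) \<ge> a + b + (b / c) (t - c)\<close>, and integrating the tail yields
  \<open>E[Y] \<le> c + (c / b) h(a) / w(a) = 3 c\<close>. Eliminating \<open>c\<close> gives the claim with
  \<open>C = 3\<^sup>-\<^sup>\<alpha> / (B + 1)\<close>.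
\<close>

section \<open>Derivatives within a set and convexity\<close>

lemma deriv_on_works:
  assumes "f differentiable_on S" "x \<in> S"
  shows "(f has_real_derivative deriv_on S f x) (at x within S)"
proof -
  have "f differentiable (at x within S)"
    using assms by (simp add: differentiable_on_def)
  then show ?thesis
    unfolding deriv_on_def has_real_derivative_iff_has_vector_derivative
    by (rule vector_derivative_works[THEN iffD1])
qed

lemma C2_on_has_derivs:
  assumes "C2_on S f" "x \<in> S"
  shows "(f has_real_derivative deriv_on S f x) (at x within S)"
    and "(deriv_on S f has_real_derivative deriv_on S (deriv_on S f) x) (at x within S)"
  by (rule deriv_on_works, use assms in \<open>simp_all add: C2_on_def\<close>)+

lemma at_within_nonneg: "0 < u \<Longrightarrow> at u within {0..} = at (u :: real)"
  by (intro at_within_interior) simp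

text \<open>
  The derivatives are one-sided at \<open>0\<close>, so the standard criterion, which asks for a two-sided
  derivative at every point of the domain, does not cover the left endpoint.
\<close>

lemma convex_on_C2:
  fixes f :: "real \<Rightarrow> real"
  assumes C2: "C2_on {0..} f" and nonneg: "\<And>x. 0 \<le> x \<Longrightarrow> 0 \<le> deriv_on {0..} (deriv_on {0..} f) x"
  shows "convex_on {0..} f"
proof (rule convex_on_linorderI)
  let ?f' = "deriv_on {0..} f" and ?f'' = "deriv_on {0..} (deriv_on {0..} f)"
  have cont: "continuous_on {0..} f" "continuous_on {0..} ?f'"
    using C2 by (auto simp: C2_on_def intro: differentiable_imp_continuous_on)
  have d1: "(f has_real_derivative ?f' u) (at u)" and d2: "(?f' has_real_derivative ?f'' u) (at u)"
    if "0 < u" for u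
    using C2_on_has_derivs[OF C2, of u] that by (simp_all add: at_within_nonneg)
  have f'_mono: "?f' u \<le> ?f' v" if "0 < u" "u < v" for u v
  proof -
    obtain \<xi> where "u < \<xi>" "\<xi> < v" "?f' v - ?f' u = (v - u) * ?f'' \<xi>"
      using MVT2[OF \<open>u < v\<close>, of ?f' ?f''] d2 \<open>0 < u\<close> by (meson less_le_trans)
    moreover have "0 \<le> (v - u) * ?f'' \<xi>"
      using nonneg[of \<xi>] \<open>u < \<xi>\<close> that by simp
    ultimately show ?thesis by simp
  qed
  have mvt_f: "\<exists>\<xi>. u < \<xi> \<and> \<xi> < v \<and> f v - f u = (v - u) * ?f' \<xi>" if "0 \<le> u" "u < v" for u v
  proof -
    have "continuous_on {u..v} f"
      using cont(1) by (rule continuous_on_subset) (use that in auto)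
    moreover have "(f has_derivative (*) (?f' \<xi>)) (at \<xi>)" if "u < \<xi>" "\<xi> < v" for \<xi>
      using d1[of \<xi>] that \<open>0 \<le> u\<close> by (simp add: has_field_derivative_def)
    ultimately obtain \<xi> where "u < \<xi>" "\<xi> < v" "f v - f u = ?f' \<xi> * (v - u)"
      by (rule mvt[OF \<open>u < v\<close>])
    then show ?thesis by (auto simp: mult.commute)
  qed
  fix t x y :: real
  assume t: "0 < t" "t < 1" and xy: "x \<in> {0..}" "y \<in> {0..}" "x < y"
  define z where "z = (1 - t) * x + t * y"
  have zx: "z - x = t * (y - x)" and yz: "y - z = (1 - t) * (y - x)"
    by (simp_all add: z_def algebra_simps)
  have "x < z" "z < y"
    using mult_pos_pos[of t "y - x"] mult_pos_pos[of "1 - t" "y - x"] zx yz t xy by linarith+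
  obtain \<xi> \<eta> where \<xi>: "x < \<xi>" "\<xi> < z" "f z - f x = (z - x) * ?f' \<xi>"
      and \<eta>: "z < \<eta>" "\<eta> < y" "f y - f z = (y - z) * ?f' \<eta>"
    using mvt_f[of x z] mvt_f[of z y] \<open>x < z\<close> \<open>z < y\<close> xy
    by (metis atLeast_iff less_imp_le order_trans)
  have "?f' \<xi> \<le> ?f' \<eta>"
    using f'_mono \<xi> \<eta> xy by simp
  then have "(t * (1 - t) * (y - x)) * ?f' \<xi> \<le> (t * (1 - t) * (y - x)) * ?f' \<eta>"
    using t xy by (intro mult_left_mono) auto
  then have "(1 - t) * (f z - f x) \<le> t * (f y - f z)"
    unfolding \<xi>(3) \<eta>(3) zx yz by (simp add: ac_simps)
  then show "f ((1 - t) *\<^sub>R x + t *\<^sub>R y) \<le> (1 - t) * f x + t * f y"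
    unfolding real_scaleR_def z_def[symmetric] by (simp add: algebra_simps)
qed simp

section \<open>Convex reparametrizations of the half-line\<close>

text \<open>
  The functions \<open>G\<close> through which the tails of the iterates arise from the initial tail: strictly
  increasing, convex and continuous maps from \<open>[0,\<infinity>)\<close> into itself. Values at negative arguments are
  irrelevant, and \<open>G 0 = 0\<close> is not required. Convexity leaves continuity open only at \<open>0\<close>, where
  it is needed to solve \<open>G c = y\<close> for every \<open>y > G 0\<close>.
\<close>

definition convex_gauge :: "(real \<Rightarrow> real) \<Rightarrow> bool" where
  "convex_gauge G \<longleftrightarrow> convex_on {0..} G \<and> continuous_on {0..} G \<and> strict_mono_on {0..} G \<and> 0 \<le> G 0"

lemma convex_gauge_nonneg: "convex_gauge G \<Longrightarrow> 0 \<le> x \<Longrightarrow> 0 \<le> G x"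
  using strict_mono_on_leD[of "{0..}" G 0 x] by (simp add: convex_gauge_def)

lemma convex_gauge_id: "convex_gauge (\<lambda>x. x)"
  by (auto simp: convex_gauge_def convex_on_def strict_mono_on_def continuous_on_id)

lemma convex_gauge_admissible:
  assumes "admissible F"
  shows "convex_gauge F"
proof -
  have C2: "C2_on {0..} F" and F': "\<And>x. 0 \<le> x \<Longrightarrow> 0 < deriv_on {0..} F x"
    and F'': "\<And>x. 0 \<le> x \<Longrightarrow> 0 \<le> deriv_on {0..} (deriv_on {0..} F) x" and "0 < F 0"
    using assms by (auto simp: admissible_def)
  have cont: "continuous_on {0..} F"
    using C2 by (auto simp: C2_on_def intro: differentiable_imp_continuous_on)
  have "F x < F y" if "0 \<le> x" "x < y" for x y
  proof -
    have cont': "continuous_on {x..y} F"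
      using cont by (rule continuous_on_subset) (use that in auto)
    have der: "(F has_real_derivative deriv_on {0..} F u) (at u)" if "x < u" for u
      using C2_on_has_derivs(1)[OF C2, of u] that \<open>0 \<le> x\<close>
      by (simp add: at_within_nonneg)
    show ?thesis
    proof (rule DERIV_pos_imp_increasing_open[OF \<open>x < y\<close> _ cont'])
      fix u assume "x < u" "u < y"
      then show "\<exists>d. (F has_real_derivative d) (at u) \<and> 0 < d"
        using der[of u] F'[of u] \<open>0 \<le> x\<close> by (intro exI[of _ "deriv_on {0..} F u"]) simp
    qed
  qed
  then have "strict_mono_on {0..} F" by (intro strict_mono_onI) simp
  with convex_on_C2[OF C2 F''] cont \<open>0 < F 0\<close> show ?thesis
    by (simp add: convex_gauge_def)
qed

lemma convex_gauge_compose: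
  assumes G: "convex_gauge G" and F: "convex_gauge F" and "0 < l"
  shows "convex_gauge (\<lambda>x. G (F x / l))"
proof -
  have F0: "0 \<le> F x / l" if "0 \<le> x" for x
    using convex_gauge_nonneg[OF F that] \<open>0 < l\<close> by simp
  have G_mono: "G x \<le> G y" if "0 \<le> x" "x \<le> y" for x y
    using G strict_mono_on_leD[of "{0..}" G x y] that by (auto simp: convex_gauge_def)
  have "convex_on {0..} (\<lambda>x. G (F x / l))"
  proof (rule convex_on_linorderI)
    fix t x y :: real
    assume t: "0 < t" "t < 1" and xy: "x \<in> {0..}" "y \<in> {0..}" "x < y"
    let ?z = "(1 - t) * x + t * y"
    have z: "0 \<le> ?z" using t xy by simp
    have "F ?z \<le> (1 - t) * F x + t * F y"
      using convex_onD[of "{0..}" F t x y] F t xy by (auto simp: convex_gauge_def)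
    then have "F ?z / l \<le> (1 - t) * (F x / l) + t * (F y / l)"
      using \<open>0 < l\<close> by (simp add: field_simps)
    then have "G (F ?z / l) \<le> G ((1 - t) * (F x / l) + t * (F y / l))"
      by (intro G_mono F0 z)
    also have "\<dots> \<le> (1 - t) * G (F x / l) + t * G (F y / l)"
      using convex_onD[of "{0..}" G t "F x / l" "F y / l"] G t xy F0
      by (auto simp: convex_gauge_def)
    finally show "G (F ((1 - t) *\<^sub>R x + t *\<^sub>R y) / l) \<le> (1 - t) * G (F x / l) + t * G (F y / l)"
      by simp
  qed simp
  moreover have "continuous_on {0..} (\<lambda>x. G (F x / l))"
  proof (rule continuous_on_compose2[of "{0..}" G])
    show "continuous_on {0..} G" using G by (simp add: convex_gauge_def)
    show "continuous_on {0..} (\<lambda>x. F x / l)"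
      using F \<open>0 < l\<close> by (intro continuous_on_divide) (auto simp: convex_gauge_def)
  qed (use F0 in auto)
  moreover have "strict_mono_on {0..} (\<lambda>x. G (F x / l))"
  proof (rule strict_mono_onI)
    fix x y :: real assume "x \<in> {0..}" "y \<in> {0..}" "x < y"
    then have "F x / l < F y / l"
      using F strict_mono_onD[of "{0..}" F x y] \<open>0 < l\<close>
      by (simp add: convex_gauge_def divide_strict_right_mono)
    then show "G (F x / l) < G (F y / l)"
      using G strict_mono_onD[of "{0..}" G "F x / l" "F y / l"] F0 \<open>x \<in> {0..}\<close> \<open>y \<in> {0..}\<close>
      by (simp add: convex_gauge_def)
  qed
  ultimately show ?thesis
    using convex_gauge_nonneg[OF G F0, of 0] by (simp add: convex_gauge_def)
qed

lemma convex_gauge_secant: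
  assumes "convex_gauge G" "0 < c" "c \<le> x"
  shows "G c + (x - c) * ((G c - G 0) / c) \<le> G x"
proof (cases "c = x")
  case False
  have cv: "convex_on {0..} G" using assms(1) by (simp add: convex_gauge_def)
  from False assms have "(G 0 - G c) / (0 - c) \<le> (G c - G x) / (c - x)"
    using convex_on_slope_le[OF cv, of 0 x c] by force
  then show ?thesis
    using assms False by (simp add: field_simps)
qed simp

text \<open>A strictly increasing convex function is unbounded, so it takes every value above \<open>G 0\<close>.\<close>

lemma convex_gauge_surj:
  assumes G: "convex_gauge G" and "G 0 < y"
  obtains c where "0 < c" "G c = y"
proof -
  have s: "0 < G 1 - G 0"
    using G strict_mono_onD[of "{0..}" G 0 1] by (auto simp: convex_gauge_def)
  \<comment> \<open>the point where the secant through \<open>0\<close> and \<open>1\<close> has climbed \<open>y - G 0\<close> above \<open>G 1\<close>\<close>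
  define x where "x = 1 + (y - G 0) / (G 1 - G 0)"
  have x1: "1 \<le> x" using s assms by (simp add: x_def)
  have "y \<le> G 1 + (x - 1) * ((G 1 - G 0) / 1)"
    using s by (simp add: x_def)
  also have "\<dots> \<le> G x"
    by (rule convex_gauge_secant[OF G _ x1]) simp
  finally have "y \<le> G x" .
  moreover have "continuous_on {0..x} G"
    using G by (auto simp: convex_gauge_def intro: continuous_on_subset)
  ultimately obtain c where c: "0 \<le> c" "G c = y"
    using IVT'[of G 0 y x] assms x1 by force
  with \<open>G 0 < y\<close> have "c \<noteq> 0" by auto
  with c show ?thesis by (intro that[of c]) auto
qed

section \<open>Tails of positive random variables\<close>

locale positive_random_variable =
  fixes M :: "'a measure" and X :: "'a \<Rightarrow> real"
  assumes positive: "positive_rv M X"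
begin

sublocale prob_space M
  using positive by (simp add: positive_rv_def)

lemma measurable_X [measurable]: "X \<in> borel_measurable M"
  and X_pos: "AE \<omega> in M. 0 < X \<omega>"
  using positive by (auto simp: positive_rv_def)

lemma tail_antimono: "x \<le> y \<Longrightarrow> tail M X y \<le> tail M X x"
  unfolding tail_def by (intro finite_measure_mono) auto

lemma tail_nonneg: "0 \<le> tail M X x"
  by (simp add: tail_def)

lemma tail_measurable [measurable]: "tail M X \<in> borel_measurable borel"
proof -
  have "mono (\<lambda>x. - tail M X x)" by (auto simp: mono_def intro: tail_antimono)
  from borel_measurable_mono[OF this] show ?thesis by simp
qed

lemma tail_0: "tail M X 0 = 1"
  unfolding tail_def using X_pos by (intro prob_eq_1[THEN iffD2]) auto

lemma tail_pos_iff: "0 < tail M X x \<longleftrightarrow> ereal x < ess_bound M X"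
proof
  assume "ereal x < ess_bound M X"
  then have "emeasure M {\<omega> \<in> space M. ereal (X \<omega>) > ereal x} > 0"
    unfolding ess_bound_def by (intro esssup_pos_measure) auto
  then show "0 < tail M X x"
    by (simp add: tail_def emeasure_eq_measure)
next
  assume pos: "0 < tail M X x"
  show "ereal x < ess_bound M X"
  proof (rule ccontr)
    assume "\<not> ereal x < ess_bound M X"
    moreover have "AE \<omega> in M. ereal (X \<omega>) \<le> ess_bound M X"
      unfolding ess_bound_def by (rule esssup_AE)
    ultimately have "AE \<omega> in M. \<not> X \<omega> > x"
      by (auto simp: not_less elim!: eventually_mono dest: order_trans)
    then have "tail M X x = 0"
      unfolding tail_def by (intro prob_eq_0[THEN iffD2]) auto
    with pos show False by simp
  qed
qed

lemma beta_domain_eq: "beta_domain M X = {x. 0 \<le> x \<and> 0 < tail M X x}"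
  by (simp add: beta_domain_def tail_pos_iff)

lemma tail_right_continuous: "(tail M X \<longlongrightarrow> tail M X x) (at_right x)"
proof -
  interpret D: real_distribution "distr M borel X" by simp
  have "tail M X = (\<lambda>y. 1 - cdf (distr M borel X) y)"
  proof
    fix y
    have "prob {\<omega> \<in> space M. \<not> X \<omega> \<le> y} = 1 - prob {\<omega> \<in> space M. X \<omega> \<le> y}"
      by (rule prob_neg) simp
    then show "tail M X y = 1 - cdf (distr M borel X) y"
      by (simp add: tail_def cdf_def measure_distr not_le vimage_def Int_def conj_commute)
  qed
  moreover have "(cdf (distr M borel X) \<longlongrightarrow> cdf (distr M borel X) x) (at_right x)"
    using D.cdf_is_right_cont[of x] by (simp add: continuous_within)
  ultimately show ?thesis by (simp add: tendsto_diff)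
qed

text \<open>
  The layer-cake formula \<open>E[X] = \<integral>\<^sub>0\<^sup>\<infinity> P(X > t) dt\<close>, stated for nonnegative integrals so that it also
  serves to establish integrability.
\<close>

lemma nn_integral_eq_tail:
  "(\<integral>\<^sup>+\<omega>. ennreal (X \<omega>) \<partial>M) = (\<integral>\<^sup>+t\<in>{0..}. ennreal (tail M X t) \<partial>lborel)"
proof -
  interpret pair_sigma_finite lborel M ..
  have "(\<integral>\<^sup>+\<omega>. ennreal (X \<omega>) \<partial>M)
      = (\<integral>\<^sup>+\<omega>. (\<integral>\<^sup>+t. indicator {0..} t * indicator {..<X \<omega>} t \<partial>lborel) \<partial>M)"
  proof (intro nn_integral_cong)
    fix \<omega>
    have "(\<integral>\<^sup>+t. indicator {0..} t * indicator {..<X \<omega>} t \<partial>lborel)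
        = (\<integral>\<^sup>+t. indicator {0..<X \<omega>} t \<partial>lborel)"
      by (intro nn_integral_cong) (auto split: split_indicator)
    then show "ennreal (X \<omega>) = (\<integral>\<^sup>+t. indicator {0..} t * indicator {..<X \<omega>} t \<partial>lborel)"
      by (cases "0 \<le> X \<omega>") (auto simp: ennreal_neg)
  qed
  also have "\<dots> = (\<integral>\<^sup>+t. (\<integral>\<^sup>+\<omega>. indicator {0..} t * indicator {..<X \<omega>} t \<partial>M) \<partial>lborel)"
    by (rule Fubini') (simp add: indicator_def, measurable)
  also have "\<dots> = (\<integral>\<^sup>+t\<in>{0..}. ennreal (tail M X t) \<partial>lborel)"
  proof (intro nn_integral_cong)
    fix t :: real
    have "(\<integral>\<^sup>+\<omega>. indicator {0..} t * indicator {..<X \<omega>} t \<partial>M)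
        = (\<integral>\<^sup>+\<omega>. indicator {0..} t * indicator {\<omega> \<in> space M. X \<omega> > t} \<omega> \<partial>M)"
      by (intro nn_integral_cong) (auto split: split_indicator)
    also have "\<dots> = ennreal (tail M X t) * indicator {0..} t"
      by (simp add: nn_integral_cmult_indicator tail_def emeasure_eq_measure mult.commute)
    finally show "(\<integral>\<^sup>+\<omega>. indicator {0..} t * indicator {..<X \<omega>} t \<partial>M)
        = ennreal (tail M X t) * indicator {0..} t" .
  qed
  finally show ?thesis .
qed

end

section \<open>The integrated tail and the mean residual life\<close>

locale integrable_positive_random_variable = positive_random_variable +
  assumes integrable: "integrable M X"
begin

abbreviation w :: "real \<Rightarrow> real" where "w \<equiv> tail M X"
abbreviation h :: "real \<Rightarrow> real" where "h \<equiv> tail_integral M X"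

lemma tail_integrable:
  assumes "0 \<le> x"
  shows "set_integrable lborel {x..} w"
proof -
  have "(\<integral>\<^sup>+t\<in>{x..}. ennreal (w t) \<partial>lborel) \<le> (\<integral>\<^sup>+t\<in>{0..}. ennreal (w t) \<partial>lborel)"
    using assms by (intro nn_integral_mono) (auto split: split_indicator)
  also have "\<dots> = (\<integral>\<^sup>+\<omega>. ennreal (X \<omega>) \<partial>M)"
    by (simp add: nn_integral_eq_tail)
  also have "\<dots> = (\<integral>\<^sup>+\<omega>. ennreal (norm (X \<omega>)) \<partial>M)"
    using X_pos by (intro nn_integral_cong_AE) auto
  also have "\<dots> < \<infinity>"
    using integrable by (simp add: integrable_iff_bounded)
  finally have fin: "(\<integral>\<^sup>+t\<in>{x..}. ennreal (w t) \<partial>lborel) < \<infinity>" .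
  have "(\<integral>\<^sup>+t. ennreal (norm (indicator {x..} t *\<^sub>R w t)) \<partial>lborel)
      = (\<integral>\<^sup>+t\<in>{x..}. ennreal (w t) \<partial>lborel)"
    by (intro nn_integral_cong) (auto simp: tail_nonneg split: split_indicator)
  with fin show ?thesis
    unfolding set_integrable_def integrable_iff_bounded by auto
qed

lemma nn_integral_tail:
  assumes "0 \<le> x"
  shows "(\<integral>\<^sup>+t\<in>{x..}. ennreal (w t) \<partial>lborel) = ennreal (h x)"
proof -
  have "(\<integral>\<^sup>+t\<in>{x..}. ennreal (w t) \<partial>lborel)
      = (\<integral>\<^sup>+t. ennreal (indicator {x..} t *\<^sub>R w t) \<partial>lborel)"
    by (intro nn_integral_cong) (auto split: split_indicator)
  also have "\<dots> = ennreal (h x)"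
    using tail_integrable[OF assms] unfolding tail_integral_def set_lebesgue_integral_def
      set_integrable_def
    by (intro nn_integral_eq_integral) (auto simp: tail_nonneg split: split_indicator)
  finally show ?thesis .
qed

lemma tail_integral_diff:
  assumes "0 \<le> x" "x \<le> y"
  shows "(y - x) * w y \<le> h x - h y" "h x - h y \<le> (y - x) * w x"
proof -
  have I: "set_integrable lborel {x..<y} w"
    by (rule set_integrable_subset[OF tail_integrable[OF assms(1)]]) auto
  have "{x..} = {x..<y} \<union> {y..}" using assms by auto
  then have "h x = (LINT t:{x..<y}|lborel. w t) + h y"
    unfolding tail_integral_def using I tail_integrable[of y] assms
      set_integral_Un[of "{x..<y}" "{y..}" lborel w] by force
  moreover have const: "set_integrable lborel {x..<y} (\<lambda>_. k)"
      "(LINT t:{x..<y}|lborel. k) = (y - x) * k" for k :: real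
    using assms by (auto simp: set_integrable_def set_lebesgue_integral_def)
  moreover have "(LINT t:{x..<y}|lborel. w y) \<le> (LINT t:{x..<y}|lborel. w t)"
    by (intro set_integral_mono I const) (auto intro: tail_antimono)
  moreover have "(LINT t:{x..<y}|lborel. w t) \<le> (LINT t:{x..<y}|lborel. w x)"
    by (intro set_integral_mono I const) (auto intro: tail_antimono)
  ultimately show "(y - x) * w y \<le> h x - h y" "h x - h y \<le> (y - x) * w x"
    by simp_all
qed

lemma tail_integral_nonneg: "0 \<le> h x"
  unfolding tail_integral_def set_lebesgue_integral_def
  by (intro integral_nonneg_AE) (auto simp: tail_nonneg)

text \<open>
  A tail that is positive at \<open>x\<close> is positive slightly to the right of \<open>x\<close>, by right continuity.
  Hence one-sided derivatives from the right make sense at every point of the domain.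
\<close>

lemma beta_domain_right_nbhd:
  assumes "x \<in> beta_domain M X"
  obtains u where "x < u" "{x..u} \<subseteq> beta_domain M X"
proof -
  have "0 < w x" using assms by (simp add: beta_domain_eq)
  then have "eventually (\<lambda>u. 0 < w u) (at_right x)"
    using tail_right_continuous[of x] by (rule order_tendstoD(1)[rotated])
  then obtain v where "x < v" "\<And>y. x < y \<Longrightarrow> y < v \<Longrightarrow> 0 < w y"
    by (auto simp: eventually_at_right_field)
  then have "0 < w ((x + v) / 2)" "x < (x + v) / 2" by auto
  moreover have "{x..(x + v) / 2} \<subseteq> beta_domain M X"
    using assms calculation(1) tail_antimono[of _ "(x + v) / 2"]
    by (auto simp: beta_domain_eq intro: less_le_trans)
  ultimately show ?thesis using that by blast
qed

lemma tail_integral_pos: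
  assumes "x \<in> beta_domain M X"
  shows "0 < h x"
proof -
  obtain u where u: "x < u" "{x..u} \<subseteq> beta_domain M X"
    using beta_domain_right_nbhd[OF assms] by blast
  have "0 < w u" "0 \<le> x"
    using u assms by (auto simp: beta_domain_eq subset_iff)
  then have "0 < (u - x) * w u" using u by simp
  also have "\<dots> \<le> h x - h u" using tail_integral_diff(1)[of x u] u \<open>0 \<le> x\<close> by simp
  finally show ?thesis using tail_integral_nonneg[of u] by simp
qed

text \<open>
  No continuity of the tail is assumed. The right difference quotients of \<open>h\<close> at \<open>x\<close> tend to
  \<open>- w x\<close> by right continuity alone, and this determines the derivative, which exists by hypothesis.
\<close>

lemma deriv_tail_integral:
  assumes C2: "C2_on (beta_domain M X) h" and x: "x \<in> beta_domain M X"
  shows "deriv_on (beta_domain M X) h x = - w x"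
proof -
  let ?d = "deriv_on (beta_domain M X) h x"
  have "0 \<le> x" using x by (simp add: beta_domain_eq)
  obtain u where u: "x < u" "{x..u} \<subseteq> beta_domain M X"
    using beta_domain_right_nbhd[OF x] by blast
  have "(h has_real_derivative ?d) (at x within {x..u})"
    using C2_on_has_derivs(1)[OF C2 x] u(2) by (rule DERIV_subset)
  then have 1: "((\<lambda>y. (h y - h x) / (y - x)) \<longlongrightarrow> ?d) (at_right x)"
    using u(1) by (simp add: has_field_derivative_iff at_within_Icc_at_right)
  have 2: "((\<lambda>y. (h y - h x) / (y - x)) \<longlongrightarrow> - w x) (at_right x)"
  proof (rule tendsto_sandwich)
    show "eventually (\<lambda>y. - w x \<le> (h y - h x) / (y - x)) (at_right x)"
      using eventually_at_right_less[of x]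
      by eventually_elim (use tail_integral_diff(2)[OF \<open>0 \<le> x\<close>] in \<open>force simp: field_simps\<close>)
    show "eventually (\<lambda>y. (h y - h x) / (y - x) \<le> - w y) (at_right x)"
      using eventually_at_right_less[of x]
      by eventually_elim (use tail_integral_diff(1)[OF \<open>0 \<le> x\<close>] in \<open>force simp: field_simps\<close>)
    show "((\<lambda>y. - w y) \<longlongrightarrow> - w x) (at_right x)"
      by (intro tendsto_minus tail_right_continuous)
    show "((\<lambda>y. - w x) \<longlongrightarrow> - w x) (at_right x)" by simp
  qed
  show ?thesis
    by (rule tendsto_unique[OF _ 1 2]) simp
qed

text \<open>
  The mean value theorem for the mean residual life \<open>h / w = - h / h'\<close>, whose derivative is
  \<open>(h h'' - h'\<^sup>2) / h'\<^sup>2\<close>, the beta function minus one.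
\<close>

lemma mean_residual_life_growth:
  assumes C2: "C2_on (beta_domain M X) h"
    and B: "\<And>x. x \<in> beta_domain M X \<Longrightarrow> beta_function M X x \<le> B"
    and "0 \<le> a" "a < c" "0 < w c"
  shows "h c / w c \<le> h a / w a + (B - 1) * (c - a)"
proof -
  let ?S = "beta_domain M X"
  let ?h' = "deriv_on ?S h"
  let ?h'' = "deriv_on ?S ?h'"
  have S: "{a..c} \<subseteq> ?S"
    using assms tail_antimono[of _ c] by (auto simp: beta_domain_eq intro: less_le_trans)
  have h': "?h' x = - w x" "?h' x \<noteq> 0" if "x \<in> ?S" for x
    using deriv_tail_integral[OF C2 that] that by (auto simp: beta_domain_eq)
  have der: "((\<lambda>x. - h x / ?h' x) has_real_derivative beta_function M X x - 1) (at x within ?S)"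
    if "x \<in> ?S" for x
    using C2_on_has_derivs[OF C2 that] h'(2)[OF that]
    by (auto intro!: derivative_eq_intros
        simp: beta_function_def Let_def power2_eq_square field_simps)
  have "continuous_on {a..c} (\<lambda>x. - h x / ?h' x)"
    using der S by (intro DERIV_continuous_on) (blast intro: DERIV_subset)
  moreover have "((\<lambda>x. - h x / ?h' x) has_derivative (\<lambda>k. (beta_function M X x - 1) * k)) (at x)"
    if "a < x" "x < c" for x
  proof -
    have "x \<in> interior ?S"
      using that S interior_mono[OF S] by auto
    then have "at x within ?S = at x" "x \<in> ?S"
      using interior_subset by (auto intro: at_within_interior)
    with der[of x] show ?thesis
      by (simp add: has_field_derivative_def)
  qed
  ultimately obtain \<xi> where \<xi>: "a < \<xi>" "\<xi> < c"
    "- h c / ?h' c - (- h a / ?h' a) = (beta_function M X \<xi> - 1) * (c - a)"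
    using mvt[OF \<open>a < c\<close>, of "\<lambda>x. - h x / ?h' x"
        "\<lambda>x k. (beta_function M X x - 1) * k"] by auto
  have "(beta_function M X \<xi> - 1) * (c - a) \<le> (B - 1) * (c - a)"
    using B[of \<xi>] subsetD[OF S, of \<xi>] \<xi>(1,2) \<open>a < c\<close> by (intro mult_right_mono) auto
  moreover have "?h' a = - w a" "?h' c = - w c"
    using S \<open>a < c\<close> by (auto intro!: h'(1))
  ultimately show ?thesis using \<xi>(3) by simp
qed

text \<open>
  The only consequence of the bounded beta function that the moment inequality needs: advancing by
  half of the mean residual life loses at most the factor \<open>B + 1\<close> in the tail.
\<close>

lemma tail_at_half_residual_life:
  assumes C2: "C2_on (beta_domain M X) h"
    and B: "\<And>x. x \<in> beta_domain M X \<Longrightarrow> beta_function M X x \<le> B" and "0 \<le> B"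
    and a: "a \<in> beta_domain M X"
  shows "w a / (B + 1) \<le> w (a + h a / w a / 2)"
proof -
  define m where "m = h a / w a"
  define c where "c = a + m / 2"
  have a': "0 \<le> a" "0 < w a" using a by (auto simp: beta_domain_eq)
  have m: "0 < m" using tail_integral_pos[OF a] a' by (simp add: m_def)
  have ac: "a < c" using m by (simp add: c_def)
  have "h a = m * w a" using a' by (simp add: m_def)
  then have hc: "w a * m / 2 \<le> h c"
    using tail_integral_diff(2)[of a c] a' ac by (simp add: c_def algebra_simps)
  \<comment> \<open>\<open>c\<close> is still below the essential supremum, since \<open>h c > 0\<close>\<close>
  have wc: "0 < w c"
  proof (rule ccontr)
    assume "\<not> 0 < w c"
    then have w0: "w t = 0" if "c \<le> t" for t
      using tail_antimono[OF that] tail_nonneg[of t] by simp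
    have "h c = (LINT t:{c..}|lborel. 0)"
      unfolding tail_integral_def by (intro set_lebesgue_integral_cong) (auto simp: w0)
    then have "h c = 0" by (simp add: set_lebesgue_integral_def)
    moreover have "0 < w a * m / 2" using a' m by simp
    ultimately show False using hc by simp
  qed
  have "h c / w c \<le> m + (B - 1) * (m / 2)"
    using mean_residual_life_growth[OF C2 B a'(1) ac wc] by (simp add: m_def c_def)
  then have "h c \<le> (m / 2 * (B + 1)) * w c"
    using wc by (simp add: field_simps)
  with hc have "(m / 2) * w a \<le> (m / 2) * ((B + 1) * w c)"
    by (simp add: ac_simps)
  then have "w a \<le> (B + 1) * w c" using m by simp
  then show ?thesis
    using \<open>0 \<le> B\<close> by (simp add: field_simps c_def m_def)
qed

end

section \<open>Tails of the iterates\<close>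

lemma tail_scale: "0 < l \<Longrightarrow> tail M (\<lambda>\<omega>. l * X \<omega>) x = tail M X (x / l)"
  by (simp add: tail_def field_simps)

lemma T_iteration_tail:
  assumes F: "admissible F" and T: "T_iteration F l M X" and pos0: "positive_rv (M 0) (X 0)"
  obtains G where "convex_gauge G" "0 < tail (M 0) (X 0) (G 0)"
    "\<And>x. 0 \<le> x \<Longrightarrow> tail (M n) (X n) x = tail (M 0) (X 0) (G x) / tail (M 0) (X 0) (G 0)"
proof -
  let ?w = "tail (M 0) (X 0)"
  have "\<exists>G. convex_gauge G \<and> 0 < ?w (G 0) \<and> (\<forall>x\<ge>0. tail (M n) (X n) x = ?w (G x) / ?w (G 0))"
  proof (induction n)
    case 0
    interpret positive_random_variable "M 0" "X 0" by unfold_locales (rule pos0)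
    show ?case
      using convex_gauge_id tail_0 by (intro exI[of _ "\<lambda>x. x"]) auto
  next
    case (Suc n)
    then obtain G where G: "convex_gauge G" "0 < ?w (G 0)"
      "\<And>x. 0 \<le> x \<Longrightarrow> tail (M n) (X n) x = ?w (G x) / ?w (G 0)" by blast
    have l: "0 < l n" and less: "ereal (F 0) < ereal (l n) * ess_bound (M n) (X n)"
      and isT: "is_T F (M n) (\<lambda>\<omega>. l n * X n \<omega>) (M (Suc n)) (X (Suc n))"
      using T by (auto simp: T_iteration_def)
    have "positive_rv (M n) (X n)"
      using pos0 T by (cases n) (auto simp: T_iteration_def is_T_def)
    then interpret positive_random_variable "M n" "X n" by unfold_locales
    note F' = convex_gauge_admissible[OF F]
    have F0: "0 \<le> F x / l n" if "0 \<le> x" for x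
      using convex_gauge_nonneg[OF F' that] l by simp
    have "ereal (F 0 / l n) < ess_bound (M n) (X n)"
      using less l by (cases "ess_bound (M n) (X n)") (auto simp: field_simps)
    then have "0 < tail (M n) (X n) (F 0 / l n)"
      by (simp add: tail_pos_iff)
    then have w0: "0 < ?w (G (F 0 / l n))"
      using G F0[of 0] by (simp add: zero_less_divide_iff)
    have "tail (M (Suc n)) (X (Suc n)) x = ?w (G (F x / l n)) / ?w (G (F 0 / l n))"
      if "0 \<le> x" for x
      using isT that G F0 by (simp add: is_T_def tail_scale[OF l])
    with w0 convex_gauge_compose[OF G(1) F' l] show ?case by blast
  qed
  with that show ?thesis by blast
qed

section \<open>The moment inequality\<close>

lemma moment_inequality:
  assumes X: "integrable_positive_random_variable M X" and Y: "positive_rv N Y"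
    and C2: "C2_on (beta_domain M X) (tail_integral M X)"
    and B: "\<And>x. x \<in> beta_domain M X \<Longrightarrow> beta_function M X x \<le> B" "0 \<le> B"
    and G: "convex_gauge G" "0 < tail M X (G 0)"
    and tail: "\<And>x. 0 \<le> x \<Longrightarrow> tail N Y x = tail M X (G x) / tail M X (G 0)"
    and \<alpha>: "0 < \<alpha>" "\<alpha> < 1"
  shows "(\<integral>\<omega>. Y \<omega> powr \<alpha> \<partial>N) \<ge> (1 / 3) powr \<alpha> / (B + 1) * (\<integral>\<omega>. Y \<omega> \<partial>N) powr \<alpha>"
proof -
  interpret X: integrable_positive_random_variable M X by fact
  interpret Y: positive_random_variable N Y by unfold_locales fact
  let ?w = "tail M X" and ?h = "tail_integral M X"
  define a where "a = G 0"
  define b where "b = ?h a / ?w a / 2"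
  have a: "a \<in> beta_domain M X" "0 < ?w a" "0 \<le> a"
    using G convex_gauge_nonneg[OF G(1), of 0] by (auto simp: a_def X.beta_domain_eq)
  have b: "0 < b" using X.tail_integral_pos[OF a(1)] a by (simp add: b_def)
  have wb: "?w a / (B + 1) \<le> ?w (a + b)"
    unfolding b_def by (rule X.tail_at_half_residual_life[OF C2 B a(1)])
  obtain c where c: "0 < c" "G c = a + b"
    using convex_gauge_surj[OF G(1), of "a + b"] b by (auto simp: a_def)
  have tail_c: "1 / (B + 1) \<le> tail N Y c"
    using tail[of c] c a divide_right_mono[OF wb, of "?w a"] by (simp add: a_def[symmetric])

  \<comment> \<open>beyond \<open>c\<close>, replace \<open>G\<close> by its secant through \<open>0\<close> and \<open>c\<close>, then substitute
    \<open>s = a + b + (b / c) (t - c)\<close>\<close>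
  have "(\<integral>\<^sup>+t\<in>{c..}. ennreal (tail N Y t) \<partial>lborel)
      \<le> (\<integral>\<^sup>+t. ennreal (1 / ?w a) * (ennreal (?w (a + b + (b / c) * (t - c)))
            * indicator {a + b..} (a + b + (b / c) * (t - c))) \<partial>lborel)"
  proof (intro nn_integral_mono)
    fix t :: real
    show "ennreal (tail N Y t) * indicator {c..} t
      \<le> ennreal (1 / ?w a) * (ennreal (?w (a + b + (b / c) * (t - c)))
            * indicator {a + b..} (a + b + (b / c) * (t - c)))"
    proof (cases "c \<le> t")
      case True
      have "a + b + (b / c) * (t - c) \<le> G t"
        using convex_gauge_secant[OF G(1) c(1) True] c by (simp add: a_def[symmetric] mult.commute)
      then have "tail N Y t \<le> 1 / ?w a * ?w (a + b + (b / c) * (t - c))"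
        using tail[of t] True c a X.tail_antimono
        by (simp add: a_def[symmetric] divide_right_mono)
      moreover have "0 \<le> (b / c) * (t - c)" using b c True by simp
      ultimately show ?thesis
        using True a by (simp add: ennreal_mult[symmetric] X.tail_nonneg ennreal_leI)
    qed simp
  qed
  also have "\<dots> = ennreal (1 / ?w a) * (\<integral>\<^sup>+t. ennreal (?w (a + b + (b / c) * (t - c)))
            * indicator {a + b..} (a + b + (b / c) * (t - c)) \<partial>lborel)"
    by (intro nn_integral_cmult) measurable
  also have "(\<integral>\<^sup>+t. ennreal (?w (a + b + (b / c) * (t - c)))
            * indicator {a + b..} (a + b + (b / c) * (t - c)) \<partial>lborel)
      = ennreal (c / b) * (\<integral>\<^sup>+s\<in>{a + b..}. ennreal (?w s) \<partial>lborel)"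
  proof -
    have eq: "a + b + (b / c) * ((c - (a + b) * (c / b)) + (c / b) * s - c) = s" for s
      using b c by (simp add: field_simps)
    show ?thesis
      by (subst nn_integral_real_affine[of _ "c / b" "c - (a + b) * (c / b)"])
        (use b c in \<open>simp_all only: eq, auto\<close>)
  qed
  also have "(\<integral>\<^sup>+s\<in>{a + b..}. ennreal (?w s) \<partial>lborel) = ennreal (?h (a + b))"
    using a b by (intro X.nn_integral_tail) simp
  also have "?h (a + b) \<le> ?h a"
    using X.tail_integral_diff(1)[of a "a + b"] a b X.tail_nonneg[of "a + b"]
    by (smt (verit) mult_nonneg_nonneg)
  also have "ennreal (1 / ?w a) * (ennreal (c / b) * ennreal (?h a)) = ennreal (2 * c)"
  proof -
    have "?h a = 2 * b * ?w a" using a by (simp add: b_def)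
    then have "1 / ?w a * (c / b * ?h a) = 2 * c" using a b by simp
    then show ?thesis
      using a b c X.tail_integral_nonneg[of a] by (simp add: ennreal_mult[symmetric])
  qed
  finally have upper: "(\<integral>\<^sup>+t\<in>{c..}. ennreal (tail N Y t) \<partial>lborel) \<le> ennreal (2 * c)"
    by (simp add: mult_left_mono ennreal_leI)

  \<comment> \<open>on \<open>[0, c)\<close> the tail is at most \<open>1\<close>\<close>
  have "(\<integral>\<^sup>+\<omega>. ennreal (Y \<omega>) \<partial>N) = (\<integral>\<^sup>+t\<in>{0..}. ennreal (tail N Y t) \<partial>lborel)"
    by (rule Y.nn_integral_eq_tail)
  also have "\<dots> \<le> (\<integral>\<^sup>+t. indicator {0..<c} t + ennreal (tail N Y t) * indicator {c..} t \<partial>lborel)"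
    by (intro nn_integral_mono) (auto simp: tail_def split: split_indicator)
  also have "\<dots> = ennreal c + (\<integral>\<^sup>+t\<in>{c..}. ennreal (tail N Y t) \<partial>lborel)"
    using c by (subst nn_integral_add) auto
  also have "\<dots> \<le> ennreal c + ennreal (2 * c)"
    by (intro add_left_mono upper)
  also have "\<dots> = ennreal (3 * c)"
    using c by (subst ennreal_plus[symmetric]) auto
  finally have EY: "(\<integral>\<^sup>+\<omega>. ennreal (Y \<omega>) \<partial>N) \<le> ennreal (3 * c)" .
  have nn_abs: "(\<integral>\<^sup>+\<omega>. ennreal (norm (Y \<omega>)) \<partial>N) = (\<integral>\<^sup>+\<omega>. ennreal (Y \<omega>) \<partial>N)"
    using Y.X_pos by (intro nn_integral_cong_AE) auto
  have intY: "integrable N Y"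
    unfolding integrable_iff_bounded nn_abs using EY le_less_trans by fastforce
  have Y_nonneg: "0 \<le> (\<integral>\<omega>. Y \<omega> \<partial>N)"
    using Y.X_pos by (intro integral_nonneg_AE) auto
  have "ennreal (\<integral>\<omega>. Y \<omega> \<partial>N) \<le> ennreal (3 * c)"
    using EY Y.X_pos by (subst nn_integral_eq_integral[OF intY, symmetric]) auto
  then have mean: "(\<integral>\<omega>. Y \<omega> \<partial>N) \<le> 3 * c"
    using c by (simp add: ennreal_le_iff)

  \<comment> \<open>without integrability the integral of \<open>Y powr \<alpha>\<close> would be \<open>0\<close> by convention\<close>
  have int\<alpha>: "integrable N (\<lambda>\<omega>. Y \<omega> powr \<alpha>)"
  proof (rule Bochner_Integration.integrable_bound)
    show "integrable N (\<lambda>\<omega>. 1 + Y \<omega>)" using intY by simp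
    show "AE \<omega> in N. norm (Y \<omega> powr \<alpha>) \<le> norm (1 + Y \<omega>)"
      using Y.X_pos
    proof eventually_elim
      case (elim \<omega>)
      have "Y \<omega> powr \<alpha> \<le> (1 + Y \<omega>) powr \<alpha>" using elim \<alpha> by (intro powr_mono2) auto
      also have "\<dots> \<le> (1 + Y \<omega>) powr 1" using elim \<alpha> by (intro powr_mono) auto
      finally show ?case using elim by simp
    qed
  qed simp
  have "(1 / 3) powr \<alpha> / (B + 1) * (\<integral>\<omega>. Y \<omega> \<partial>N) powr \<alpha>
      \<le> (1 / 3) powr \<alpha> / (B + 1) * (3 * c) powr \<alpha>"
    using mean Y_nonneg \<alpha> B(2) by (intro mult_left_mono powr_mono2) auto
  also have "\<dots> = c powr \<alpha> * (1 / (B + 1))"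
    using c by (simp add: powr_mult powr_divide)
  also have "\<dots> \<le> c powr \<alpha> * tail N Y c"
    by (intro mult_left_mono tail_c) auto
  also have "\<dots> = (\<integral>\<omega>. c powr \<alpha> * indicator {\<omega> \<in> space N. Y \<omega> > c} \<omega> \<partial>N)"
    by (simp add: tail_def)
  also \<comment> \<open>Markov's inequality\<close>
  have "\<dots> \<le> (\<integral>\<omega>. Y \<omega> powr \<alpha> \<partial>N)"
    using c \<alpha> by (intro integral_mono int\<alpha>)
      (auto split: split_indicator intro: powr_mono2 simp: Y.emeasure_eq_measure)
  finally show ?thesis .
qed

theorem proposition3p1:
  fixes M0 :: "'a measure" and X0 :: "'a \<Rightarrow> real" and \<alpha> :: real
  assumes "positive_rv M0 X0" and "integrable M0 X0"
    and "has_bounded_beta M0 X0"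
    and "0 < \<alpha>" and "\<alpha> < 1"
  shows "\<exists>C>0. \<forall>(F :: real \<Rightarrow> real) (l :: nat \<Rightarrow> real)
           (M :: nat \<Rightarrow> 'a measure) (X :: nat \<Rightarrow> 'a \<Rightarrow> real).
           admissible F \<and> M 0 = M0 \<and> X 0 = X0 \<and> T_iteration F l M X \<longrightarrow>
           (\<forall>n. (\<integral>\<omega>. X n \<omega> powr \<alpha> \<partial>M n) \<ge> C * (\<integral>\<omega>. X n \<omega> \<partial>M n) powr \<alpha>)"
proof -
  interpret integrable_positive_random_variable M0 X0
    using assms by unfold_locales
  have loc: "integrable_positive_random_variable M0 X0" ..
  obtain B' where B': "\<And>x. x \<in> beta_domain M0 X0 \<Longrightarrow> \<bar>beta_function M0 X0 x\<bar> \<le> B'"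
    and C2: "C2_on (beta_domain M0 X0) (tail_integral M0 X0)"
    using assms by (auto simp: has_bounded_beta_def)
  define B where "B = max 0 B'"
  have B: "\<And>x. x \<in> beta_domain M0 X0 \<Longrightarrow> beta_function M0 X0 x \<le> B" "0 \<le> B"
    using B' by (force simp: B_def)+
  show ?thesis
  proof (intro exI[of _ "(1 / 3) powr \<alpha> / (B + 1)"] conjI allI impI)
    show "0 < (1 / 3) powr \<alpha> / (B + 1)" using B(2) by simp
    fix F :: "real \<Rightarrow> real" and l :: "nat \<Rightarrow> real" and M :: "nat \<Rightarrow> 'a measure"
      and X :: "nat \<Rightarrow> 'a \<Rightarrow> real" and n
    assume *: "admissible F \<and> M 0 = M0 \<and> X 0 = X0 \<and> T_iteration F l M X"
    then obtain G where G: "convex_gauge G" "0 < tail M0 X0 (G 0)"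
      "\<And>x. 0 \<le> x \<Longrightarrow> tail (M n) (X n) x = tail M0 X0 (G x) / tail M0 X0 (G 0)"
      using T_iteration_tail[of F l M X n] assms(1) by metis
    have "positive_rv (M n) (X n)"
      using * assms(1) by (cases n) (auto simp: T_iteration_def is_T_def)
    from moment_inequality[OF loc this C2 B G assms(4,5)]
    show "(1 / 3) powr \<alpha> / (B + 1) * (\<integral>\<omega>. X n \<omega> \<partial>M n) powr \<alpha> \<le> (\<integral>\<omega>. X n \<omega> powr \<alpha> \<partial>M n)" .
  qed
qed

end
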